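(* Let $(\mathcal{L},[\cdot,\cdot],\alpha)$ and $(\mathcal{L}',[\cdot,\cdot]',\alpha')$ be multiplicative Hom-Lie algebras over $\mathbb{K}$, let $\phi:\mathcal{L}\to\mathcal{L}'$ be a Hom-Lie algebra morphism, and let $\Pi=\mathcal{L}'$ be regarded as a representation of $\mathcal{L}$ via $\phi$. Then the operators $\delta^n_{HL}:\widetilde{C}^n_{\alpha,\alpha'}(\mathcal{L},\Pi)\to\widetilde{C}^{n+1}_{\alpha,\alpha'}(\mathcal{L},\Pi)$, $n\ge1$, satisfy $$\delta^{n+1}_{HL}\circ\delta^n_{HL}=0 .$$
   Context: $\mathbb{K}$ is an algebraically closed field of characteristic $0$. A Hom-Lie algebra $(\mathcal{L},[\cdot,\cdot],\alpha)$ is a vector space with a skew-symmetric bilinear bracket and a linear map $\alpha$ such that $[\alpha(x),[y,z]]+[\alpha(y),[z,x]]+[\alpha(z),[x,y]]=0$; it is multiplicative if $\alpha([x,y])=[\alpha(x),\alpha(y)]$. A Hom-Lie algebra morphism is a linear map $\phi$ with $[\phi(x),\phi(y)]'=\phi([x,y])$ and $\phi\circ\alpha=\alpha'\circ\phi$. The representation $\Pi=\mathcal{L}'$ of $\mathcal{L}$ via $\phi$ has action $(x,v)\mapsto[\phi(x),v]'$ and twisting map $\alpha'$. $\widetilde{C}^n_{\alpha,\alpha'}(\mathcal{L},\Pi)$ is the space of skew-symmetric $n$-linear maps $f:\mathcal{L}^{\times n}\to\Pi$ with $\alpha'(f(u_1,\dots,u_n))=f(\alpha(u_1),\dots,\alpha(u_n))$.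 For $n\ge1$, $$\delta^n_{HL}\varphi(x_0,\dots,x_n)=\sum_{i=0}^n(-1)^i[\phi(\alpha^{n-1}(x_i)),\varphi(x_0,\dots,\widehat{x_i},\dots,x_n)]'+\sum_{0\le i<j\le n}(-1)^{i+j}\varphi([x_i,x_j],\alpha(x_0),\dots,\widehat{x_i},\dots,\widehat{x_j},\dots,\alpha(x_n)),$$ where a hat means the argument is omitted, and all arguments following $[x_i,x_j]$ in the second sum have $\alpha$ applied. *)

theory Defs
  imports "HOL-Computational_Algebra.Polynomial"
begin

locale hom_lie_algebra = vector_space scale
  for scale :: "'k::field \<Rightarrow> 'a::ab_group_add \<Rightarrow> 'a" +
  fixes br :: "'a \<Rightarrow> 'a \<Rightarrow> 'a"
    and \<alpha> :: "'a \<Rightarrow> 'a"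
  assumes br_linear_left: "Vector_Spaces.linear scale scale (\<lambda>x. br x y)"
    and br_linear_right: "Vector_Spaces.linear scale scale (\<lambda>y. br x y)"
    and br_skew: "br x y = - br y x"
    and twist_linear: "Vector_Spaces.linear scale scale \<alpha>"
    and hom_jacobi: "br (\<alpha> x) (br y z) + br (\<alpha> y) (br z x) + br (\<alpha> z) (br x y) = 0"

locale multiplicative_hom_lie_algebra = hom_lie_algebra +
  assumes twist_br: "\<alpha> (br x y) = br (\<alpha> x) (\<alpha> y)"

locale hom_lie_morphism =
  dom: hom_lie_algebra scale br \<alpha> + cod: hom_lie_algebra scale' br' \<alpha>'
  for scale :: "'k::field \<Rightarrow> 'a::ab_group_add \<Rightarrow> 'a"
    and br :: "'a \<Rightarrow> 'a \<Rightarrow> 'a" and \<alpha> :: "'a \<Rightarrow> 'a"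
    and scale' :: "'k \<Rightarrow> 'b::ab_group_add \<Rightarrow> 'b"
    and br' :: "'b \<Rightarrow> 'b \<Rightarrow> 'b" and \<alpha>' :: "'b \<Rightarrow> 'b" +
  fixes \<phi> :: "'a \<Rightarrow> 'b"
  assumes morphism_linear: "Vector_Spaces.linear scale scale' \<phi>"
    and morphism_br: "br' (\<phi> x) (\<phi> y) = \<phi> (br x y)"
    and morphism_twist: "\<phi> (\<alpha> x) = \<alpha>' (\<phi> x)"

text \<open>
  A map of \<open>n\<close> arguments is a function on argument lists of length \<open>n\<close>. Cochains take the
  value \<open>0\<close> on lists of any other length, so that equality of cochains is equality of functions.
  Skew-symmetry says that interchanging the arguments in positions \<open>i < j\<close> changes the sign.
\<close>

definition hl_cochains ::
  "('k::field \<Rightarrow> 'a::ab_group_add \<Rightarrow> 'a) \<Rightarrow> ('k \<Rightarrow> 'b::ab_group_add \<Rightarrow> 'b) \<Rightarrow>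
   ('a \<Rightarrow> 'a) \<Rightarrow> ('b \<Rightarrow> 'b) \<Rightarrow> nat \<Rightarrow> ('a list \<Rightarrow> 'b) set"
where
  "hl_cochains scale scale' \<alpha> \<alpha>' n = {f.
     (\<forall>xs i. length xs = n \<and> i < n \<longrightarrow>
        Vector_Spaces.linear scale scale' (\<lambda>v. f (xs[i := v]))) \<and>
     (\<forall>xs i j. length xs = n \<and> i < j \<and> j < n \<longrightarrow>
        f (xs[i := xs ! j, j := xs ! i]) = - f xs) \<and>
     (\<forall>xs. length xs = n \<longrightarrow> \<alpha>' (f xs) = f (map \<alpha> xs)) \<and>
     (\<forall>xs. length xs \<noteq> n \<longrightarrow> f xs = 0)}"

text \<open>
  The term \<open>nths xs (- {i, j})\<close> is the list \<open>xs\<close> with positions \<open>i\<close> and \<open>j\<close> omitted. The action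
  of \<open>x\<close> on \<open>v\<close> in the representation via \<open>\<phi>\<close> is \<open>br' (\<phi> x) v\<close>. The definition is meant for
  \<open>n \<ge> 1\<close>.
\<close>

definition hl_delta ::
  "('a \<Rightarrow> 'a \<Rightarrow> 'a) \<Rightarrow> ('a \<Rightarrow> 'a) \<Rightarrow>
   ('k::field \<Rightarrow> 'b::ab_group_add \<Rightarrow> 'b) \<Rightarrow> ('b \<Rightarrow> 'b \<Rightarrow> 'b) \<Rightarrow> ('a \<Rightarrow> 'b) \<Rightarrow>
   nat \<Rightarrow> ('a list \<Rightarrow> 'b) \<Rightarrow> 'a list \<Rightarrow> 'b"
where
  "hl_delta br \<alpha> scale' br' \<phi> n f xs =
     (if length xs = n + 1 then
        (\<Sum>i\<le>n. scale' ((-1) ^ i) (br' (\<phi> ((\<alpha> ^^ (n - 1)) (xs ! i))) (f (nths xs (- {i}))))) +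
        (\<Sum>j\<le>n. \<Sum>i<j. scale' ((-1) ^ (i + j))
           (f (br (xs ! i) (xs ! j) # map \<alpha> (nths xs (- {i, j})))))
      else 0)"

end

theory Submission
  imports Defs
begin

text \<open>
  Write the coboundary as \<open>\<delta> f = A f + B f\<close>, where \<open>A\<close> removes one argument and \<open>B\<close> removes two.
  Sums over removed arguments, with the sign of the removed positions, obey a Fubini principle:
  removing \<open>z\<close> and then \<open>x, y\<close> is the same as removing \<open>x, y\<close> and then \<open>z\<close>, while exchanging the
  order in which two single arguments are removed costs a sign. So in \<open>\<delta> (\<delta> f)\<close> the
  terms of \<open>A (A f)\<close> cancel against the action of \<open>[x, y]\<close> in \<open>B (A f)\<close> by the representation
  property, the remaining terms of \<open>B (A f)\<close> cancel \<open>A (B f)\<close>, and \<open>B (B f)\<close> vanishes by the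
  Hom-Jacobi identity for the iterated brackets and by skew-symmetry of \<open>f\<close> in two disjoint brackets.
  The Fubini principle and the closure of cochains under \<open>\<delta>\<close> follow by
  induction once the sums are defined by recursion on the argument list.
\<close>

section \<open>Signed sums over removed arguments\<close>

text \<open>An entry of the tail sits one position further right in the whole list, hence the minus
  sign. Unfolded, this is the alternating sum over positions, as in
  \<open>del_sum_conv_sum\<close>.\<close>

primrec del_sum :: "('a \<Rightarrow> 'a list \<Rightarrow> 'b::ab_group_add) \<Rightarrow> 'a list \<Rightarrow> 'b" where
  "del_sum F [] = 0"
| "del_sum F (x # xs) = F x xs - del_sum (\<lambda>y ys. F y (x # ys)) xs"

text \<open>A pair inside the tail shifts by two positions in total and keeps its sign; a pair
  containing the head shifts by one and changes it.\<close>

primrec del2_sum :: "('a \<Rightarrow> 'a \<Rightarrow> 'a list \<Rightarrow> 'b::ab_group_add) \<Rightarrow> 'a list \<Rightarrow> 'b" where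
  "del2_sum G [] = 0"
| "del2_sum G (x # xs) = del2_sum (\<lambda>y z ys. G y z (x # ys)) xs - del_sum (G x) xs"

section \<open>Additivity, vanishing and naturality of the signed sums\<close>

lemma del_sum_zero [simp]: "del_sum (\<lambda>x ys. 0) xs = 0"
  by (induction xs) auto

lemma del2_sum_zero [simp]: "del2_sum (\<lambda>x y ys. 0) xs = 0"
  by (induction xs) auto

lemma del_sum_add: "del_sum (\<lambda>x ys. F x ys + G x ys) xs = del_sum F xs + del_sum G xs"
  by (induction xs arbitrary: F G) (auto simp: algebra_simps)

lemma del_sum_minus: "del_sum (\<lambda>x ys. - F x ys) xs = - del_sum F xs"
  by (induction xs arbitrary: F) (auto simp: algebra_simps)

lemma del_sum_diff: "del_sum (\<lambda>x ys. F x ys - G x ys) xs = del_sum F xs - del_sum G xs"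
  using del_sum_add[of F "\<lambda>x ys. - G x ys" xs] by (simp add: del_sum_minus)

lemma del2_sum_add: "del2_sum (\<lambda>x y ys. F x y ys + G x y ys) xs = del2_sum F xs + del2_sum G xs"
  by (induction xs arbitrary: F G) (auto simp: algebra_simps del_sum_add)

lemma del2_sum_minus: "del2_sum (\<lambda>x y ys. - F x y ys) xs = - del2_sum F xs"
  by (induction xs arbitrary: F) (auto simp: algebra_simps del_sum_minus)

lemma del2_sum_diff: "del2_sum (\<lambda>x y ys. F x y ys - G x y ys) xs = del2_sum F xs - del2_sum G xs"
  using del2_sum_add[of F "\<lambda>x y ys. - G x y ys" xs] by (simp add: del2_sum_minus)

lemma del_sum_eq_0:
  assumes "\<And>x ys. Suc (length ys) = length xs \<Longrightarrow> F x ys = 0"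
  shows "del_sum F xs = 0"
  using assms by (induction xs arbitrary: F) auto

lemma del2_sum_eq_0:
  assumes "\<And>x y ys. Suc (Suc (length ys)) = length xs \<Longrightarrow> G x y ys = 0"
  shows "del2_sum G xs = 0"
  using assms by (induction xs arbitrary: G) (auto simp: del_sum_eq_0)

lemma del_sum_map: "del_sum F (map a xs) = del_sum (\<lambda>x ys. F (a x) (map a ys)) xs"
  by (induction xs arbitrary: F) auto

lemma del2_sum_map: "del2_sum G (map a xs) = del2_sum (\<lambda>x y ys. G (a x) (a y) (map a ys)) xs"
  by (induction xs arbitrary: G) (auto simp: del_sum_map)

lemma additive_del_sum:
  assumes "additive h"
  shows "h (del_sum F xs) = del_sum (\<lambda>x ys. h (F x ys)) xs"
  by (induction xs arbitrary: F) (auto simp: additive.zero[OF assms] additive.diff[OF assms])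

lemma additive_del2_sum:
  assumes "additive h"
  shows "h (del2_sum G xs) = del2_sum (\<lambda>x y ys. h (G x y ys)) xs"
  by (induction xs arbitrary: G)
    (auto simp: additive.zero[OF assms] additive.diff[OF assms] additive_del_sum[OF assms])

text \<open>Each pair is removed in two orders. Removing the earlier entry first moves the later one
  down a position and flips the sign; removing the later one first moves nothing.\<close>

lemma del_sum_del_sum:
  "del_sum (\<lambda>x. del_sum (F x)) xs = del2_sum (\<lambda>x y ys. F y x ys - F x y ys) xs"
proof (induction xs arbitrary: F)
  case (Cons a xs)
  show ?case
    using Cons[of "\<lambda>x y ys. F x y (a # ys)"] by (simp add: del_sum_diff)
qed simp

lemma del_sum_swap: "del_sum (\<lambda>x. del_sum (F x)) xs = - del_sum (\<lambda>y. del_sum (\<lambda>x. F x y)) xs"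
  by (simp add: del_sum_del_sum flip: del2_sum_minus)

text \<open>One order of removal shifts positions once for each of \<open>x\<close>,
  \<open>y\<close> behind \<open>z\<close>, the other once for each in front of it. These counts add
  up to 2, so the signs agree.\<close>

lemma del_sum_del2_sum:
  "del_sum (\<lambda>z. del2_sum (F z)) xs = del2_sum (\<lambda>x y. del_sum (\<lambda>z. F z x y)) xs"
proof (induction xs arbitrary: F)
  case (Cons a xs)
  show ?case
    using Cons[of "\<lambda>z x y ys. F z x y (a # ys)"] del_sum_swap[of "\<lambda>z. F z a" xs]
    by (simp add: del_sum_diff del2_sum_diff)
qed simp

text \<open>A triple in list order arises three times, with its first, middle or last entry as the
  single one. The relative signs +, -, + are those of the hypothesis.\<close>

lemma del_sum_del2_sum_eq_0:
  assumes "\<And>x y z ys. F x y z ys - F y x z ys + F z x y ys = 0"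
  shows "del_sum (\<lambda>z. del2_sum (F z)) xs = 0"
  using assms
proof (induction xs arbitrary: F)
  case (Cons a xs)
  have "del_sum (\<lambda>z. del2_sum (F z)) (a # xs)
      = del2_sum (F a) xs + del_sum (\<lambda>z. del_sum (F z a)) xs
        - del_sum (\<lambda>z. del2_sum (\<lambda>x y ys. F z x y (a # ys))) xs"
    by (simp add: del_sum_diff)
  \<comment> \<open>The triples avoiding \<open>a\<close> vanish by induction; those containing
    \<open>a\<close> become one sum over ordered pairs.\<close>
  also have "\<dots> = del2_sum (\<lambda>x y ys. F a x y ys + (F y a x ys - F x a y ys)) xs"
    using Cons.IH[of "\<lambda>z x y ys. F z x y (a # ys)"] Cons.prems
    by (simp add: del_sum_del_sum del2_sum_add)
  also have "(\<lambda>x y ys. F a x y ys + (F y a x ys - F x a y ys)) = (\<lambda>x y ys. 0)"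
    using Cons.prems[of a] by (intro ext) (metis add_diff_eq diff_add_eq)
  finally show ?case by simp
qed simp

text \<open>Of the four comparisons between an entry of one pair and an entry of the other, each
  causes a shift in exactly one of the two orders of removal. Four is even, so the signs
  agree.\<close>

lemma del2_sum_commute:
  "del2_sum (\<lambda>x y. del2_sum (F x y)) xs = del2_sum (\<lambda>z w. del2_sum (\<lambda>x y. F x y z w)) xs"
proof (induction xs arbitrary: F)
  case (Cons a xs)
  show ?case
    using Cons[of "\<lambda>x y z w ys. F x y z w (a # ys)"]
    by (simp add: del2_sum_diff del_sum_del2_sum)
qed simp

text \<open>The values lie in a mere abelian group here, so division by 2 is left to
  \<open>eq_minus_self_imp_0\<close>.\<close>

lemma del2_sum_swap:
  assumes "\<And>x y z w ys. F x y z w ys = - F z w x y ys"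
  shows "del2_sum (\<lambda>x y. del2_sum (F x y)) xs = - del2_sum (\<lambda>x y. del2_sum (F x y)) xs"
proof -
  \<comment> \<open>As a rewrite rule the hypothesis would loop; as an equation of functions it is
    applied once.\<close>
  have "F = (\<lambda>x y z w ys. - F z w x y ys)"
    by (intro ext) (rule assms)
  then have "del2_sum (\<lambda>x y. del2_sum (F x y)) xs
      = del2_sum (\<lambda>x y. del2_sum (\<lambda>z w ys. - F z w x y ys)) xs"
    by (rule arg_cong)
  also have "del2_sum (\<lambda>x y. del2_sum (\<lambda>z w ys. - F z w x y ys)) xs
      = - del2_sum (\<lambda>x y. del2_sum (\<lambda>z w. F z w x y)) xs"
  proof -
    have "del2_sum (\<lambda>z w ys. - F z w x y ys) = (\<lambda>ys. - del2_sum (\<lambda>z w. F z w x y) ys)" for x y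
      by (intro ext) (rule del2_sum_minus)
    then show ?thesis by (simp only: del2_sum_minus)
  qed
  also have "del2_sum (\<lambda>x y. del2_sum (\<lambda>z w. F z w x y)) xs = del2_sum (\<lambda>x y. del2_sum (F x y)) xs"
    by (rule del2_sum_commute[symmetric])
  finally show ?thesis .
qed

section \<open>Comparison with sums over positions\<close>

lemma nths_Cons_Suc_Compl: "nths (x # xs) (- {Suc i}) = x # nths xs (- {i})"
  by (simp add: nths_Cons Compl_eq)

lemma nths_Cons_0_Compl: "nths (x # xs) (- {0}) = xs"
  by (simp add: nths_Cons nths_all)

lemma nths_Cons_0_Suc_Compl: "nths (x # xs) (- {0, Suc j}) = nths xs (- {j})"
  by (simp add: nths_Cons Compl_eq)

lemma nths_Cons_Suc_Suc_Compl: "nths (x # xs) (- {Suc i, Suc j}) = x # nths xs (- {i, j})"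
  by (simp add: nths_Cons Compl_eq)

context vector_space
begin

lemma eq_minus_self_imp_0:
  assumes "(2 :: 'a) \<noteq> 0" and "(v :: 'b) = - v"
  shows "v = 0"
proof -
  have "2 *s v = v + v"
    using scale_left_distrib[of 1 1 v] by simp
  also have "\<dots> = 0"
    using assms(2) by (simp only: eq_neg_iff_add_eq_0)
  finally show ?thesis using assms(1) by simp
qed

lemma del_sum_conv_sum:
  "del_sum F xs = (\<Sum>i<length xs. ((-1) ^ i) *s F (xs ! i) (nths xs (- {i})))"
proof (induction xs arbitrary: F)
  case (Cons x xs)
  show ?case
    by (simp add: sum.lessThan_Suc_shift nths_Cons_Suc_Compl nths_Cons_0_Compl Cons sum_negf
        del: sum.lessThan_Suc)
qed simp

lemma del2_sum_conv_sum:
  "del2_sum G xs =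
    (\<Sum>j<length xs. \<Sum>i<j. ((-1) ^ (i + j)) *s G (xs ! i) (xs ! j) (nths xs (- {i, j})))"
proof (induction xs arbitrary: G)
  case (Cons x xs)
  show ?case
    by (simp add: sum.lessThan_Suc_shift nths_Cons_0_Suc_Compl nths_Cons_Suc_Suc_Compl Cons
        sum_subtractf sum_negf del_sum_conv_sum del: sum.lessThan_Suc)
qed simp

end

section \<open>Skew-symmetric multilinear functions of lists\<close>

text \<open>Adjacent exchanges with no bound on the length suit induction on lists;
  \<open>skew_list_swap\<close> recovers arbitrary exchanges.\<close>

definition skew_list :: "('a list \<Rightarrow> 'b::ab_group_add) \<Rightarrow> bool" where
  "skew_list f \<longleftrightarrow> (\<forall>ps x y qs. f (ps @ x # y # qs) = - f (ps @ y # x # qs))"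

definition multilinear_list ::
  "('k::field \<Rightarrow> 'a::ab_group_add \<Rightarrow> 'a) \<Rightarrow> ('k \<Rightarrow> 'b::ab_group_add \<Rightarrow> 'b) \<Rightarrow> ('a list \<Rightarrow> 'b) \<Rightarrow> bool"
where
  "multilinear_list s1 s2 f \<longleftrightarrow> (\<forall>ps qs. Vector_Spaces.linear s1 s2 (\<lambda>v. f (ps @ v # qs)))"

lemma skew_listD: "skew_list f \<Longrightarrow> f (ps @ x # y # qs) = - f (ps @ y # x # qs)"
  unfolding skew_list_def by blast

lemma skew_list_Cons: "skew_list f \<Longrightarrow> skew_list (\<lambda>xs. f (x # xs))"
  unfolding skew_list_def by (metis append_Cons)

lemma skew_list_map: "skew_list f \<Longrightarrow> skew_list (\<lambda>xs. f (map a xs))"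
  unfolding skew_list_def map_append list.map by blast

lemma skew_list_additive: "skew_list f \<Longrightarrow> additive h \<Longrightarrow> skew_list (\<lambda>xs. h (f xs))"
  unfolding skew_list_def by (metis additive.minus)

lemma skew_list_add: "skew_list f \<Longrightarrow> skew_list g \<Longrightarrow> skew_list (\<lambda>xs. f xs + g xs)"
  unfolding skew_list_def by (metis minus_add_distrib)

text \<open>Move \<open>x\<close> past \<open>q\<close>, exchange across the shorter gap, then move
  \<open>q\<close> past \<open>y\<close>: three sign changes.\<close>

lemma skew_list_swap:
  assumes "skew_list f"
  shows "f (ps @ x # qs @ y # rs) = - f (ps @ y # qs @ x # rs)"
proof (induction qs arbitrary: ps)
  case Nil
  show ?case using skew_listD[OF assms, of ps x y rs] by simp
next
  case (Cons q qs)
  have "f (ps @ x # q # qs @ y # rs) = - f (ps @ q # x # qs @ y # rs)"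
    by (rule skew_listD[OF assms])
  also have "\<dots> = f (ps @ q # y # qs @ x # rs)"
    using Cons[of "ps @ [q]"] by simp
  also have "\<dots> = - f (ps @ y # q # qs @ x # rs)"
    by (rule skew_listD[OF assms])
  finally show ?case by simp
qed

text \<open>Passes between the positional form in \<open>hl_cochains\<close> and the inductive form.
  On lists of the wrong length both sides are 0.\<close>

lemma skew_list_iff_length:
  assumes supp: "\<And>xs. length xs \<noteq> n \<Longrightarrow> f xs = 0"
  shows "skew_list f \<longleftrightarrow>
    (\<forall>xs i j. length xs = n \<and> i < j \<and> j < n \<longrightarrow> f (xs[i := xs ! j, j := xs ! i]) = - f xs)"
    (is "_ \<longleftrightarrow> ?R")
proof
  assume f: "skew_list f"
  show ?R
  proof (intro allI impI, elim conjE)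
    fix xs :: "'a list" and i j
    assume len: "length xs = n" and ij: "i < j" "j < n"
    define ps qs rs where "ps = take i xs" and "qs = take (j - Suc i) (drop (Suc i) xs)"
      and "rs = drop (Suc j) xs"
    have lens: "length ps = i" "length qs = j - Suc i"
      using len ij by (auto simp: ps_def qs_def)
    have "drop (Suc i) xs = qs @ xs ! j # rs"
      using len ij id_take_nth_drop[of "j - Suc i" "drop (Suc i) xs"]
      by (simp add: qs_def rs_def)
    then have xs: "xs = ps @ xs ! i # qs @ xs ! j # rs"
      using len ij id_take_nth_drop[of i xs] by (simp add: ps_def)
    have "xs[i := xs ! j, j := xs ! i] = ps @ xs ! j # qs @ xs ! i # rs"
      by (subst xs) (use lens ij in \<open>auto simp: list_update_append nat.split Suc_diff_Suc
          split: nat.splits\<close>)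
    then show "f (xs[i := xs ! j, j := xs ! i]) = - f xs"
      using skew_list_swap[OF f, of ps "xs ! j" qs "xs ! i" rs] xs by simp
  qed
next
  assume R: ?R
  show "skew_list f"
    unfolding skew_list_def
  proof (intro allI)
    fix ps :: "'a list" and x y qs
    let ?xs = "ps @ y # x # qs" and ?i = "length ps"
    show "f (ps @ x # y # qs) = - f ?xs"
    proof (cases "length ?xs = n")
      case True
      have "?xs[?i := ?xs ! Suc ?i, Suc ?i := ?xs ! ?i] = ps @ x # y # qs"
        by (simp add: list_update_append nth_append)
      then show ?thesis
        using R[rule_format, of ?xs ?i "Suc ?i"] True by fastforce
    next
      case False
      then show ?thesis using supp[of ?xs] supp[of "ps @ x # y # qs"] by simp
    qed
  qed
qed

text \<open>Exchanging neighbours trades the terms removing one or the other, whose signs are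
  opposite. In all other terms both neighbours remain and skewness of \<open>F\<close>
  applies.\<close>

lemma skew_list_del_sum:
  assumes "\<And>x. skew_list (F x)"
  shows "skew_list (del_sum F)"
proof -
  have "del_sum F (ps @ x # y # qs) = - del_sum F (ps @ y # x # qs)" for ps x y qs
    using assms
  proof (induction ps arbitrary: F)
    case Nil
    have "del_sum (\<lambda>z zs. F z (x # y # zs)) qs = - del_sum (\<lambda>z zs. F z (y # x # zs)) qs"
      using skew_listD[OF Nil, of _ "[]" x y] by (simp flip: del_sum_minus)
    then show ?case by simp
  next
    case (Cons p ps)
    have "del_sum (\<lambda>y ys. F y (p # ys)) (ps @ x # y # qs)
        = - del_sum (\<lambda>y ys. F y (p # ys)) (ps @ y # x # qs)"
      by (rule Cons.IH) (rule skew_list_Cons[OF Cons.prems])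
    then show ?case
      using skew_listD[OF Cons.prems, of p ps x y qs] by simp
  qed
  then show ?thesis unfolding skew_list_def by blast
qed

text \<open>The new case is the removal of both neighbours: the positions are unchanged, so the sign
  must come from skewness of \<open>G\<close> in its pair.\<close>

lemma skew_list_del2_sum:
  assumes "\<And>x y. skew_list (G x y)" and "\<And>x y ys. G x y ys = - G y x ys"
  shows "skew_list (del2_sum G)"
proof -
  have "del2_sum G (ps @ x # y # qs) = - del2_sum G (ps @ y # x # qs)" for ps x y qs
    using assms
  proof (induction ps arbitrary: G)
    case Nil
    have "del2_sum (\<lambda>z w zs. G z w (x # y # zs)) qs = - del2_sum (\<lambda>z w zs. G z w (y # x # zs)) qs"
      using skew_listD[OF Nil(1), of _ _ "[]" x y] by (simp flip: del2_sum_minus)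
    then show ?case using Nil(2)[of x y] by simp
  next
    case (Cons p ps)
    have "del2_sum (\<lambda>y z ys. G y z (p # ys)) (ps @ x # y # qs)
        = - del2_sum (\<lambda>y z ys. G y z (p # ys)) (ps @ y # x # qs)"
      by (rule Cons.IH) (auto intro: skew_list_Cons Cons.prems)
    moreover have "skew_list (del_sum (G p))"
      by (rule skew_list_del_sum) (rule Cons.prems)
    ultimately show ?case
      using skew_listD[of "del_sum (G p)" ps x y qs] by simp
  qed
  then show ?thesis unfolding skew_list_def by blast
qed

section \<open>Multilinearity of the signed sums\<close>

lemma multilinear_listD:
  "multilinear_list s1 s2 f \<Longrightarrow> Vector_Spaces.linear s1 s2 (\<lambda>v. f (ps @ v # qs))"
  unfolding multilinear_list_def by blast

lemma multilinear_list_ConsD: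
  "multilinear_list s1 s2 f \<Longrightarrow> Vector_Spaces.linear s1 s2 (\<lambda>v. f (v # qs))"
  using multilinear_listD[where ps = "[]"] by simp

lemma multilinear_list_Cons: "multilinear_list s1 s2 f \<Longrightarrow> multilinear_list s1 s2 (\<lambda>xs. f (x # xs))"
  unfolding multilinear_list_def append_Cons[symmetric] by blast

lemma multilinear_list_map:
  assumes "multilinear_list s2 s3 f" and "Vector_Spaces.linear s1 s2 a"
  shows "multilinear_list s1 s3 (\<lambda>xs. f (map a xs))"
  using Vector_Spaces.linear_compose[OF assms(2) multilinear_listD[OF assms(1)]]
  unfolding multilinear_list_def by (simp add: o_def)

lemma multilinear_list_compose:
  assumes "multilinear_list s1 s2 f" and "Vector_Spaces.linear s2 s3 h"
  shows "multilinear_list s1 s3 (\<lambda>xs. h (f xs))"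
  using Vector_Spaces.linear_compose[OF multilinear_listD[OF assms(1)] assms(2)]
  unfolding multilinear_list_def by (simp add: o_def)

context vector_space_pair
begin

lemma multilinear_list_add:
  "multilinear_list s1 s2 f \<Longrightarrow> multilinear_list s1 s2 g \<Longrightarrow> multilinear_list s1 s2 (\<lambda>xs. f xs + g xs)"
  unfolding multilinear_list_def by (intro allI linear_compose_add) auto

lemma multilinear_list_iff_length:
  assumes supp: "\<And>xs. length xs \<noteq> n \<Longrightarrow> f xs = 0"
  shows "multilinear_list s1 s2 f \<longleftrightarrow> (\<forall>xs i. length xs = n \<and> i < n \<longrightarrow> Vector_Spaces.linear s1 s2 (\<lambda>v. f (xs[i := v])))"
proof (intro iffI allI impI)
  fix xs :: "'b list" and i
  assume "multilinear_list s1 s2 f" "length xs = n \<and> i < n"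
  then show "Vector_Spaces.linear s1 s2 (\<lambda>v. f (xs[i := v]))"
    by (simp add: upd_conv_take_nth_drop multilinear_listD)
next
  assume R: "\<forall>xs i. length xs = n \<and> i < n \<longrightarrow> Vector_Spaces.linear s1 s2 (\<lambda>v. f (xs[i := v]))"
  show "multilinear_list s1 s2 f"
    unfolding multilinear_list_def
  proof (intro allI)
    fix ps qs :: "'b list"
    show "Vector_Spaces.linear s1 s2 (\<lambda>v. f (ps @ v # qs))"
    \<comment> \<open>The entry 0 is a placeholder that fixes the length and is then overwritten by
      \<open>v\<close>.\<close>
    proof (cases "length (ps @ 0 # qs) = n")
      case True
      then have "Vector_Spaces.linear s1 s2 (\<lambda>v. f ((ps @ 0 # qs)[length ps := v]))"
        using R[rule_format, of "ps @ 0 # qs" "length ps"] by simp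
      then show ?thesis by simp
    next
      case False
      then have "f (ps @ v # qs) = 0" for v by (intro supp) simp
      then show ?thesis by (simp add: linear_zero)
    qed
  qed
qed

lemma linear_del_sum:
  assumes "\<And>x ys. Vector_Spaces.linear s1 s2 (\<lambda>v. F v x ys)"
  shows "Vector_Spaces.linear s1 s2 (\<lambda>v. del_sum (F v) xs)"
  using assms by (induction xs arbitrary: F) (auto intro!: linear_zero linear_compose_sub)

lemma linear_del2_sum:
  assumes "\<And>x y ys. Vector_Spaces.linear s1 s2 (\<lambda>v. G v x y ys)"
  shows "Vector_Spaces.linear s1 s2 (\<lambda>v. del2_sum (G v) xs)"
  using assms
  by (induction xs arbitrary: G) (auto intro!: linear_zero linear_compose_sub linear_del_sum)

text \<open>The varying entry either stays in the list or is the removed one; the two hypotheses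
  cover these cases.\<close>

lemma multilinear_list_del_sum:
  assumes "\<And>x. multilinear_list s1 s2 (F x)" and "\<And>ys. Vector_Spaces.linear s1 s2 (\<lambda>v. F v ys)"
  shows "multilinear_list s1 s2 (del_sum F)"
proof -
  have "Vector_Spaces.linear s1 s2 (\<lambda>v. del_sum F (ps @ v # qs))" for ps qs
    using assms
  proof (induction ps arbitrary: F)
    case Nil
    then show ?case
      by (auto intro!: linear_compose_sub linear_del_sum multilinear_list_ConsD)
  next
    case (Cons p ps)
    have "Vector_Spaces.linear s1 s2 (\<lambda>v. del_sum (\<lambda>y ys. F y (p # ys)) (ps @ v # qs))"
      by (rule Cons.IH) (auto intro: Cons.prems multilinear_list_Cons)
    then show ?case
      using multilinear_listD[OF Cons.prems(1)] by (auto intro!: linear_compose_sub)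
  qed
  then show ?thesis unfolding multilinear_list_def by blast
qed

lemma multilinear_list_del2_sum:
  assumes "\<And>x y. multilinear_list s1 s2 (G x y)"
    and "\<And>x ys. Vector_Spaces.linear s1 s2 (\<lambda>v. G v x ys)" and "\<And>x ys. Vector_Spaces.linear s1 s2 (\<lambda>v. G x v ys)"
  shows "multilinear_list s1 s2 (del2_sum G)"
proof -
  have "Vector_Spaces.linear s1 s2 (\<lambda>v. del2_sum G (ps @ v # qs))" for ps qs
    using assms
  proof (induction ps arbitrary: G)
    case Nil
    then show ?case
      by (auto intro!: linear_compose_sub linear_del2_sum linear_del_sum multilinear_list_ConsD)
  next
    case (Cons p ps)
    have "Vector_Spaces.linear s1 s2 (\<lambda>v. del2_sum (\<lambda>y z ys. G y z (p # ys)) (ps @ v # qs))"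
      by (rule Cons.IH) (auto intro: Cons.prems multilinear_list_Cons)
    moreover have "multilinear_list s1 s2 (del_sum (G p))"
      by (rule multilinear_list_del_sum) (auto intro: Cons.prems)
    ultimately show ?case
      using multilinear_listD by (auto intro!: linear_compose_sub)
  qed
  then show ?thesis unfolding multilinear_list_def by blast
qed

lemma hl_cochains_iff:
  "f \<in> hl_cochains s1 s2 a b n \<longleftrightarrow>
    multilinear_list s1 s2 f \<and> skew_list f \<and> (\<forall>xs. length xs = n \<longrightarrow> b (f xs) = f (map a xs)) \<and>
    (\<forall>xs. length xs \<noteq> n \<longrightarrow> f xs = 0)"
  unfolding hl_cochains_def
  using multilinear_list_iff_length[of n f] skew_list_iff_length[of n f] by blast

end

section \<open>The coboundary operator\<close>

locale multiplicative_hom_lie_morphism = hom_lie_morphism +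
  assumes dom_twist_br: "\<alpha> (br x y) = br (\<alpha> x) (\<alpha> y)"
    and cod_twist_br: "\<alpha>' (br' u v) = br' (\<alpha>' u) (\<alpha>' v)"
begin

sublocale vs: vector_space_pair scale scale' ..

section \<open>The twisted action of the domain on the codomain\<close>

lemma additive_linear: "Vector_Spaces.linear s t h \<Longrightarrow> additive h"
  by (simp add: Vector_Spaces.linear_iff additive_def)

lemma linear_twist_power: "Vector_Spaces.linear scale scale (\<alpha> ^^ k)"
proof (induction k)
  case 0
  show ?case using dom.linear_id by (simp add: id_def)
next
  case (Suc k)
  show ?case
    using Vector_Spaces.linear_compose[OF Suc dom.twist_linear] by (simp add: o_def)
qed

text \<open>The exponent \<open>k\<close> stands for degree minus one, which avoids truncated
  subtraction.\<close>

definition act :: "nat \<Rightarrow> 'b \<Rightarrow> 'c \<Rightarrow> 'c" where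
  "act k x v = br' (\<phi> ((\<alpha> ^^ k) x)) v"

lemma linear_act: "Vector_Spaces.linear scale' scale' (act k x)"
  unfolding act_def by (rule cod.br_linear_right)

lemma linear_act_left: "Vector_Spaces.linear scale scale' (\<lambda>x. act k x v)"
  using Vector_Spaces.linear_compose[OF Vector_Spaces.linear_compose[OF
        linear_twist_power morphism_linear] cod.br_linear_left]
  by (simp add: act_def o_def)

text \<open>This matches the twisted arguments in \<open>B (A f)\<close> with the exponent, higher
  by one, in \<open>A (B f)\<close>.\<close>

lemma act_twist: "act k (\<alpha> x) v = act (Suc k) x v"
  by (simp add: act_def funpow_swap1)

lemma twist_act: "\<alpha>' (act k x v) = act k (\<alpha> x) (\<alpha>' v)"
  by (simp add: act_def cod_twist_br morphism_twist[symmetric] funpow_swap1)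

lemma twist_power_br: "(\<alpha> ^^ k) (br x y) = br ((\<alpha> ^^ k) x) ((\<alpha> ^^ k) y)"
  by (induction k) (auto simp: dom_twist_br)

text \<open>The representation property: Hom-Jacobi in the codomain for the images of the twisted
  \<open>x\<close> and \<open>y\<close> together with \<open>v\<close>, after skewness has moved
  \<open>v\<close> to the right.\<close>

lemma act_br:
  "act k (br x y) (\<alpha>' v) = act (Suc k) x (act k y v) - act (Suc k) y (act k x v)"
proof -
  let ?X = "\<phi> ((\<alpha> ^^ k) x)" and ?Y = "\<phi> ((\<alpha> ^^ k) y)"
  have "br' (\<alpha>' ?X) (br' ?Y v) + br' (\<alpha>' ?Y) (br' v ?X) + br' (\<alpha>' v) (br' ?X ?Y) = 0"
    by (rule cod.hom_jacobi)
  moreover have "br' (\<alpha>' ?Y) (br' v ?X) = - br' (\<alpha>' ?Y) (br' ?X v)"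
    by (metis cod.br_skew additive.minus additive_linear cod.br_linear_right)
  moreover have "br' (\<alpha>' v) (br' ?X ?Y) = - br' (br' ?X ?Y) (\<alpha>' v)"
    by (rule cod.br_skew)
  ultimately show ?thesis
    by (simp add: act_def twist_power_br morphism_br[symmetric] morphism_twist)
qed

definition delta :: "nat \<Rightarrow> ('b list \<Rightarrow> 'c) \<Rightarrow> 'b list \<Rightarrow> 'c" where
  "delta k f xs = del_sum (\<lambda>x ys. act k x (f ys)) xs
     + del2_sum (\<lambda>x y ys. f (br x y # map \<alpha> ys)) xs"

text \<open>Both sums evaluate \<open>f\<close> on lists one entry shorter than \<open>xs\<close>,
  so the support of \<open>f\<close> replaces the length test of \<open>hl_delta\<close>.\<close>

lemma hl_delta_eq_delta:
  assumes "\<And>xs. length xs \<noteq> Suc k \<Longrightarrow> f xs = 0"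
  shows "hl_delta br \<alpha> scale' br' \<phi> (Suc k) f = delta k f"
proof
  fix xs
  show "hl_delta br \<alpha> scale' br' \<phi> (Suc k) f xs = delta k f xs"
  proof (cases "length xs = Suc (Suc k)")
    case True
    then show ?thesis
      by (simp add: hl_delta_def delta_def cod.del_sum_conv_sum cod.del2_sum_conv_sum act_def
          lessThan_Suc_atMost del: sum.lessThan_Suc sum.atMost_Suc)
  next
    case False
    have "delta k f xs = 0"
      unfolding delta_def using False assms additive.zero[OF additive_linear[OF linear_act]]
      by (simp add: del_sum_eq_0 del2_sum_eq_0)
    then show ?thesis using False by (simp add: hl_delta_def)
  qed
qed

lemma delta_eq_0:
  assumes "\<And>xs. length xs \<noteq> n \<Longrightarrow> f xs = 0" and "length xs \<noteq> Suc n"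
  shows "delta k f xs = 0"
  unfolding delta_def using assms additive.zero[OF additive_linear[OF linear_act]]
  by (simp add: del_sum_eq_0 del2_sum_eq_0)

text \<open>Off degree \<open>n\<close> both sides are 0, so the equation can rewrite without a
  length condition.\<close>

lemma hl_cochains_twist:
  assumes "f \<in> hl_cochains scale scale' \<alpha> \<alpha>' n"
  shows "\<alpha>' (f xs) = f (map \<alpha> xs)"
  using assms additive.zero[OF additive_linear[OF cod.twist_linear]]
  by (cases "length xs = n") (auto simp: vs.hl_cochains_iff)

text \<open>Linearity and skewness hold for each of the two sums; compatibility with the twists
  rests on multiplicativity of both algebras.\<close>

lemma delta_in_hl_cochains:
  assumes f: "f \<in> hl_cochains scale scale' \<alpha> \<alpha>' n"
  shows "delta k f \<in> hl_cochains scale scale' \<alpha> \<alpha>' (Suc n)"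
proof -
  have ml: "multilinear_list scale scale' f" and sk: "skew_list f"
    and supp: "\<And>xs. length xs \<noteq> n \<Longrightarrow> f xs = 0"
    using f by (auto simp: vs.hl_cochains_iff)
  have add_f: "additive (\<lambda>v. f (v # xs))" for xs
    by (rule additive_linear) (rule multilinear_list_ConsD[OF ml])
  note tw = hl_cochains_twist[OF f]
  have "multilinear_list scale scale' (del_sum (\<lambda>x ys. act k x (f ys)))"
    by (intro vs.multilinear_list_del_sum multilinear_list_compose[OF ml] linear_act linear_act_left)
  moreover have "multilinear_list scale scale' (del2_sum (\<lambda>x y ys. f (br x y # map \<alpha> ys)))"
  proof (rule vs.multilinear_list_del2_sum)
    show "multilinear_list scale scale' (\<lambda>ys. f (br x y # map \<alpha> ys))" for x y
      by (rule multilinear_list_map[OF multilinear_list_Cons[OF ml] dom.twist_linear])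
    show "Vector_Spaces.linear scale scale' (\<lambda>v. f (br v x # map \<alpha> ys))" for x ys
      using Vector_Spaces.linear_compose[OF dom.br_linear_left multilinear_list_ConsD[OF ml]]
      by (simp add: o_def)
    show "Vector_Spaces.linear scale scale' (\<lambda>v. f (br x v # map \<alpha> ys))" for x ys
      using Vector_Spaces.linear_compose[OF dom.br_linear_right multilinear_list_ConsD[OF ml]]
      by (simp add: o_def)
  qed
  moreover have "skew_list (del_sum (\<lambda>x ys. act k x (f ys)))"
    by (intro skew_list_del_sum skew_list_additive[OF sk] additive_linear[OF linear_act])
  moreover have "skew_list (del2_sum (\<lambda>x y ys. f (br x y # map \<alpha> ys)))"
  proof (rule skew_list_del2_sum)
    show "skew_list (\<lambda>ys. f (br x y # map \<alpha> ys))" for x y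
      by (rule skew_list_map[OF skew_list_Cons[OF sk]])
    show "f (br x y # map \<alpha> ys) = - f (br y x # map \<alpha> ys)" for x y ys
      by (metis dom.br_skew additive.minus[OF add_f])
  qed
  moreover have "\<alpha>' (delta k f xs) = delta k f (map \<alpha> xs)" for xs
    using additive_linear[OF cod.twist_linear]
    by (simp add: delta_def additive.add additive_del_sum additive_del2_sum del_sum_map
        del2_sum_map twist_act tw dom_twist_br)
  moreover have "delta k f = (\<lambda>xs. del_sum (\<lambda>x ys. act k x (f ys)) xs
      + del2_sum (\<lambda>x y ys. f (br x y # map \<alpha> ys)) xs)"
    by (simp add: fun_eq_iff delta_def)
  ultimately show ?thesis
    using delta_eq_0[of n f _ k, OF supp]
    by (simp add: vs.hl_cochains_iff vs.multilinear_list_add skew_list_add)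
qed

lemma delta_delta:
  assumes f: "f \<in> hl_cochains scale scale' \<alpha> \<alpha>' n" and two: "(2 :: 'a) \<noteq> 0"
  shows "delta (Suc k) (delta k f) xs = 0"
proof -
  have ml: "multilinear_list scale scale' f" and sk: "skew_list f"
    using f by (auto simp: vs.hl_cochains_iff)
  have add_f: "additive (\<lambda>v. f (v # xs))" for xs
    by (rule additive_linear) (rule multilinear_list_ConsD[OF ml])
  note tw = hl_cochains_twist[OF f]
  \<comment> \<open>In \<open>B (B f)\<close>, the inner pair either contains the bracket formed by
    the outer one (\<open>?J\<close>) or is disjoint from it (\<open>?K\<close>). The mixed terms of
    \<open>A (B f)\<close> are \<open>?R\<close>.\<close>
  let ?J = "\<lambda>z x y zs. f (br (br x y) (\<alpha> z) # map \<alpha> (map \<alpha> zs))"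
  let ?K = "\<lambda>x y z w zs. f (br (\<alpha> z) (\<alpha> w) # br (\<alpha> x) (\<alpha> y) # map \<alpha> (map \<alpha> zs))"
  let ?R = "\<lambda>z x y zs. act (Suc k) z (f (br x y # map \<alpha> zs))"
  have act_delta: "act (Suc k) x (delta k f ys)
      = del_sum (\<lambda>y zs. act (Suc k) x (act k y (f zs))) ys + del2_sum (?R x) ys" for x ys
    using additive_linear[OF linear_act]
    by (simp add: delta_def additive.add additive_del_sum additive_del2_sum)
  \<comment> \<open>The argument list starts with the bracket, so the recursion splits off the terms
    removing this head. The first minus sign belongs to removals behind it, the second to pairs
    containing it.\<close>
  have delta_br: "delta k f (br x y # map \<alpha> ys) = act k (br x y) (\<alpha>' (f ys))
      - del_sum (\<lambda>z. ?R z x y) ys + del2_sum (?K x y) ys - del_sum (\<lambda>z. ?J z x y) ys" for x y ys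
    by (simp add: delta_def del_sum_map del2_sum_map act_twist tw dom_twist_br)
  \<comment> \<open>The three terms of a triple add up to minus the Hom-Jacobi expression inside
    \<open>f\<close>.\<close>
  have J: "del_sum (\<lambda>z. del2_sum (?J z)) xs = 0"
  proof (rule del_sum_del2_sum_eq_0)
    fix x y z :: 'b and ys :: "'b list"
    have "br (br y z) (\<alpha> x) - br (br x z) (\<alpha> y) + br (br x y) (\<alpha> z)
        = - (br (\<alpha> x) (br y z) + br (\<alpha> y) (br z x) + br (\<alpha> z) (br x y))"
    proof -
      have "br (\<alpha> y) (br z x) = br (br x z) (\<alpha> y)"
        by (metis dom.br_skew additive.minus additive_linear dom.br_linear_right)
      then show ?thesis
        using dom.br_skew[of "br y z" "\<alpha> x"] dom.br_skew[of "br x y" "\<alpha> z"]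
        by (simp add: algebra_simps)
    qed
    then have "f ((br (br y z) (\<alpha> x) - br (br x z) (\<alpha> y) + br (br x y) (\<alpha> z)) # map \<alpha> (map \<alpha> ys)) = 0"
      using dom.hom_jacobi additive.zero[OF add_f] by simp
    then show "?J x y z ys - ?J y x z ys + ?J z x y ys = 0"
      by (simp only: additive.add[OF add_f] additive.diff[OF add_f])
  qed
  have K: "del2_sum (\<lambda>x y. del2_sum (?K x y)) xs = 0" (is "?S = 0")
  proof -
    have "?S = - ?S"
    proof (rule del2_sum_swap)
      show "?K x y z w zs = - ?K z w x y zs" for x y z w zs
        \<comment> \<open>The disjoint brackets are the first two arguments of \<open>f\<close>,
          hence adjacent.\<close>
        by (rule skew_listD[OF sk, of "[]", unfolded append_Nil])
    qed
    with two show ?thesis by (rule cod.eq_minus_self_imp_0)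
  qed
  have "delta (Suc k) (delta k f) xs
      = del_sum (\<lambda>x. del_sum (\<lambda>y zs. act (Suc k) x (act k y (f zs)))) xs
        + del2_sum (\<lambda>x y ys. act k (br x y) (\<alpha>' (f ys))) xs
        + (del_sum (\<lambda>x. del2_sum (?R x)) xs - del2_sum (\<lambda>x y. del_sum (\<lambda>z. ?R z x y)) xs)
        + del2_sum (\<lambda>x y. del2_sum (?K x y)) xs
        - del2_sum (\<lambda>x y. del_sum (\<lambda>z. ?J z x y)) xs"
    by (simp only: delta_def[of "Suc k"] act_delta delta_br del_sum_add del2_sum_add del2_sum_diff)
      (simp only: algebra_simps)
  \<comment> \<open>The \<open>?R\<close> sums cancel by Fubini, and \<open>A (A f)\<close> becomes
    the commutator of two actions, ready for \<open>act_br\<close>.\<close>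
  also have "\<dots> = del2_sum (\<lambda>x y ys. act (Suc k) y (act k x (f ys)) - act (Suc k) x (act k y (f ys))
      + act k (br x y) (\<alpha>' (f ys))) xs"
    using J by (simp only: K del_sum_del_sum del_sum_del2_sum del2_sum_add) simp
  also have "\<dots> = 0"
    by (simp add: act_br)
  finally show ?thesis .
qed

end

theorem theorem2p7:
  fixes scale :: "'k::{alg_closed_field, field_char_0} \<Rightarrow> 'a::ab_group_add \<Rightarrow> 'a"
    and br :: "'a \<Rightarrow> 'a \<Rightarrow> 'a" and \<alpha> :: "'a \<Rightarrow> 'a"
    and scale' :: "'k \<Rightarrow> 'b::ab_group_add \<Rightarrow> 'b"
    and br' :: "'b \<Rightarrow> 'b \<Rightarrow> 'b" and \<alpha>' :: "'b \<Rightarrow> 'b"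
    and \<phi> :: "'a \<Rightarrow> 'b"
    and n :: nat
  assumes "multiplicative_hom_lie_algebra scale br \<alpha>"
    and "multiplicative_hom_lie_algebra scale' br' \<alpha>'"
    and "hom_lie_morphism scale br \<alpha> scale' br' \<alpha>' \<phi>"
    and "n \<ge> 1"
  shows "hl_delta br \<alpha> scale' br' \<phi> n ` hl_cochains scale scale' \<alpha> \<alpha>' n
           \<subseteq> hl_cochains scale scale' \<alpha> \<alpha>' (n + 1)
       \<and> (\<forall>f \<in> hl_cochains scale scale' \<alpha> \<alpha>' n.
            (hl_delta br \<alpha> scale' br' \<phi> (n + 1) \<circ> hl_delta br \<alpha> scale' br' \<phi> n) f = (\<lambda>_. 0))"
proof -
  interpret dom: multiplicative_hom_lie_algebra scale br \<alpha> by fact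
  interpret cod: multiplicative_hom_lie_algebra scale' br' \<alpha>' by fact
  interpret hom_lie_morphism scale br \<alpha> scale' br' \<alpha>' \<phi> by fact
  interpret multiplicative_hom_lie_morphism scale br \<alpha> scale' br' \<alpha>' \<phi>
    by unfold_locales (rule dom.twist_br, rule cod.twist_br)
  \<comment> \<open>With \<open>n = Suc m\<close> the exponent \<open>n - 1\<close> is exactly
    \<open>m\<close>; the two coboundaries are \<open>delta m\<close> and
    \<open>delta (Suc m)\<close>.\<close>
  obtain m where n: "n = Suc m"
    using \<open>n \<ge> 1\<close> by (cases n) auto
  have hl_delta_eq: "hl_delta br \<alpha> scale' br' \<phi> (Suc k) f = delta k f"
    if "f \<in> hl_cochains scale scale' \<alpha> \<alpha>' (Suc k)" for k f
    using that by (intro hl_delta_eq_delta) (auto simp: vs.hl_cochains_iff)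
  show ?thesis
    using delta_in_hl_cochains delta_delta by (auto simp: n hl_delta_eq fun_eq_iff)
qed

end
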